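(* Let $(X,\mathcal{X},\mu)$ be a standard Lebesgue space, let $\{\phi_t\}_{t\in\mathbb{R}}$ be a measurable, nonsingular (additive) flow on $(X,\mathcal{X},\mu)$, and let $\{A_t\}_{t\in\mathbb{R}}$ be a cocycle for $\{\phi_t\}_{t\in\mathbb{R}}$ taking values in $\mathbb{R}\setminus\{0\}$. Suppose that $\{F_t\}_{t\in\mathbb{R}}$ is an almost semi-additive functional related to the cocycle $\{A_t\}_{t\in\mathbb{R}}$ and to the flow $\{\phi_t\}_{t\in\mathbb{R}}$. Then $\{F_t\}_{t\in\mathbb{R}}$ has a version which is a semi-additive functional related to the cocycle $\{A_t\}_{t\in\mathbb{R}}$ (and the flow $\{\phi_t\}_{t\in\mathbb{R}}$).
   Context: A standard Lebesgue space is a standard Borel space with a $\sigma$-finite measure. An (additive) flow $\{\phi_t\}_{t\in\mathbb{R}}$ on $X$ is a family of maps $\phi_t:X\to X$ with $\phi_{t_1+t_2}(x)=\phi_{t_1}(\phi_{t_2}(x))$ for all $t_1,t_2\in\mathbb{R}$, $x\in X$, and $\phi_0(x)=x$ for all $x\in X$. It is measurable if $(t,x)\mapsto\phi_t(x)$ is measurable from $\mathbb{R}\times X$ to $X$, and nonsingular if $\mu(A)=0$ implies $\mu(\phi_t^{-1}(A))=0$ for every $t\in\mathbb{R}$, $A\in\mathcal{X}$. A cocycle for the flow with values in $\mathbb{R}\setminus\{0\}$ is a measurable map $(t,x)\mapsto A_t(x)$ from $\mathbb{R}\times X$ to $\mathbb{R}\setminus\{0\}$ with $A_{t_1+t_2}(x)=A_{t_1}(x)A_{t_2}(\phi_{t_1}(x))$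 for all $t_1,t_2\in\mathbb{R}$, $x\in X$. A measurable map $(t,x)\mapsto F_t(x)$ from $\mathbb{R}\times X$ to $\mathbb{R}$ is a semi-additive functional related to the cocycle $\{A_t\}$ (and the flow $\{\phi_t\}$) if $F_{t_1+t_2}(x)=F_{t_1}(x)+A_{t_1}(x)F_{t_2}(\phi_{t_1}(x))$ for all $t_1,t_2\in\mathbb{R}$ and all $x\in X$. It is an almost semi-additive functional related to the cocycle if, for all $t_1,t_2\in\mathbb{R}$, this equality holds for $\mu$-a.e. $x$ (the exceptional null set may depend on $t_1,t_2$). $\{\widetilde F_t\}_{t\in\mathbb{R}}$ is a version of $\{F_t\}_{t\in\mathbb{R}}$ if $\mu(\widetilde F_t\neq F_t)=0$ for every $t\in\mathbb{R}$. *)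

theory Defs
  imports "HOL-Analysis.Analysis"
begin

(* Polish topologies are the completely metrizable, second countable ones; T lives on the
   carrier space M, not on the whole type. *)
definition standard_borel_space :: "'a measure \<Rightarrow> bool" where
  "standard_borel_space M \<longleftrightarrow>
     (\<exists>T. completely_metrizable_space T \<and> second_countable T \<and>
          topspace T = space M \<and>
          sets M = sigma_sets (topspace T) {U. openin T U})"

definition standard_lebesgue_space :: "'a measure \<Rightarrow> bool" where
  "standard_lebesgue_space M \<longleftrightarrow> standard_borel_space M \<and> sigma_finite_measure M"

definition flow_on :: "'a set \<Rightarrow> (real \<Rightarrow> 'a \<Rightarrow> 'a) \<Rightarrow> bool" where
  "flow_on X \<phi> \<longleftrightarrow>
     (\<forall>t. \<phi> t \<in> X \<rightarrow> X) \<and>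
     (\<forall>t\<^sub>1 t\<^sub>2. \<forall>x\<in>X. \<phi> (t\<^sub>1 + t\<^sub>2) x = \<phi> t\<^sub>1 (\<phi> t\<^sub>2 x)) \<and>
     (\<forall>x\<in>X. \<phi> 0 x = x)"

definition measurable_flow :: "'a measure \<Rightarrow> (real \<Rightarrow> 'a \<Rightarrow> 'a) \<Rightarrow> bool" where
  "measurable_flow M \<phi> \<longleftrightarrow>
     flow_on (space M) \<phi> \<and> (\<lambda>(t, x). \<phi> t x) \<in> borel \<Otimes>\<^sub>M M \<rightarrow>\<^sub>M M"

definition nonsingular_flow :: "'a measure \<Rightarrow> (real \<Rightarrow> 'a \<Rightarrow> 'a) \<Rightarrow> bool" where
  "nonsingular_flow M \<phi> \<longleftrightarrow>
     flow_on (space M) \<phi> \<and>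
     (\<forall>t. \<forall>A\<in>sets M. emeasure M A = 0 \<longrightarrow> emeasure M (\<phi> t -` A \<inter> space M) = 0)"

definition flow_cocycle ::
  "'a measure \<Rightarrow> (real \<Rightarrow> 'a \<Rightarrow> 'a) \<Rightarrow> (real \<Rightarrow> 'a \<Rightarrow> real) \<Rightarrow> bool" where
  "flow_cocycle M \<phi> A \<longleftrightarrow>
     (\<lambda>(t, x). A t x) \<in> borel \<Otimes>\<^sub>M M \<rightarrow>\<^sub>M restrict_space borel (- {0}) \<and>
     (\<forall>t\<^sub>1 t\<^sub>2. \<forall>x\<in>space M. A (t\<^sub>1 + t\<^sub>2) x = A t\<^sub>1 x * A t\<^sub>2 (\<phi> t\<^sub>1 x))"

definition semi_additive_functional ::
  "'a measure \<Rightarrow> (real \<Rightarrow> 'a \<Rightarrow> 'a) \<Rightarrow> (real \<Rightarrow> 'a \<Rightarrow> real) \<Rightarrow> (real \<Rightarrow> 'a \<Rightarrow> real) \<Rightarrow> bool" where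
  "semi_additive_functional M \<phi> A F \<longleftrightarrow>
     (\<lambda>(t, x). F t x) \<in> borel_measurable (borel \<Otimes>\<^sub>M M) \<and>
     (\<forall>t\<^sub>1 t\<^sub>2. \<forall>x\<in>space M. F (t\<^sub>1 + t\<^sub>2) x = F t\<^sub>1 x + A t\<^sub>1 x * F t\<^sub>2 (\<phi> t\<^sub>1 x))"

definition almost_semi_additive_functional ::
  "'a measure \<Rightarrow> (real \<Rightarrow> 'a \<Rightarrow> 'a) \<Rightarrow> (real \<Rightarrow> 'a \<Rightarrow> real) \<Rightarrow> (real \<Rightarrow> 'a \<Rightarrow> real) \<Rightarrow> bool" where
  "almost_semi_additive_functional M \<phi> A F \<longleftrightarrow>
     (\<lambda>(t, x). F t x) \<in> borel_measurable (borel \<Otimes>\<^sub>M M) \<and>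
     (\<forall>t\<^sub>1 t\<^sub>2. AE x in M. F (t\<^sub>1 + t\<^sub>2) x = F t\<^sub>1 x + A t\<^sub>1 x * F t\<^sub>2 (\<phi> t\<^sub>1 x))"

(* AE rather than emeasure M {x : space M. G t x ~= F t x} = 0, because emeasure is 0 on
   non-measurable sets. The two agree for jointly measurable F and G. *)
definition version_of ::
  "'a measure \<Rightarrow> (real \<Rightarrow> 'a \<Rightarrow> real) \<Rightarrow> (real \<Rightarrow> 'a \<Rightarrow> real) \<Rightarrow> bool" where
  "version_of M G F \<longleftrightarrow> (\<forall>t. AE x in M. G t x = F t x)"

end

theory Submission
  imports Defs
begin

text \<open>
  Suppose an exact functional \<open>G\<close> were at hand. Up to an additive constant, the function
  \<open>s \<mapsto> G\<^sub>s(x)\<close> could then be read off at any point \<open>\<phi>\<^sub>r(x)\<close> of the orbit, as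
  \<open>s \<mapsto> A\<^sub>r(x) G\<^bsub>s-r\<^esub>(\<phi>\<^sub>r(x))\<close>. For the almost semi-additive \<open>F\<close> we call \<open>x\<close> consistent if for
  almost all \<open>r, r'\<close> the profiles \<open>s \<mapsto> A\<^sub>r(x) F\<^bsub>s-r\<^esub>(\<phi>\<^sub>r(x))\<close> seen from \<open>r\<close> and \<open>r'\<close> differ by a
  constant almost everywhere. By Fubini almost every point is consistent, and since the condition
  ignores null sets of \<open>r\<close>, the set of consistent points is exactly flow-invariant.

  Let \<open>p\<^sub>r(x)\<close> be the median over \<open>[0,1]\<close> of the profile seen from \<open>r\<close>. The median commutes with
  adding constants, so on consistent points \<open>A\<^sub>t(x) p\<^bsub>r-t\<^esub>(\<phi>\<^sub>t(x)) - p\<^sub>r(x)\<close> is almost everywhere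
  constant in \<open>r\<close>. The constant value, extended by 0, is an exact semi-additive functional, and adding
  the coboundary \<open>p\<^sub>0(x) - A\<^sub>t(x) p\<^sub>0(\<phi>\<^sub>t(x))\<close> turns it into a version of \<open>F\<close>.
\<close>

section \<open>Almost-everywhere quantifiers: translation, measurability, Fubini\<close>

lemma AE_lborel_translate:
  fixes P :: "real \<Rightarrow> bool"
  assumes "AE s in lborel. P s"
  shows "AE s in lborel. P (s + t)"
proof -
  from assms obtain N where N: "{s \<in> space lborel. \<not> P s} \<subseteq> N" "emeasure lborel N = 0" "N \<in> sets lborel"
    by (rule AE_E)
  have "AE s in lborel. s \<notin> N"
    using N by (intro AE_not_in) (auto simp: null_sets_def)
  then have "AE s in lborel. t + 1 * s \<notin> N"
    using N(3) by (intro AE_borel_affine) auto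
  then show ?thesis
    by eventually_elim (use N(1) in \<open>auto simp: add.commute\<close>)
qed

text \<open>Lebesgue measure is nonzero. An identity shown for almost every \<open>r\<close> but not
  mentioning \<open>r\<close> therefore holds outright.\<close>

lemma AE_lborel_const [simp]: "(AE s in (lborel :: real measure). c) \<longleftrightarrow> c"
  by (simp add: AE_iff_null null_sets_def)

text \<open>The measure of the exceptional section depends measurably on the parameter, so sets cut
  out by nested \<open>AE\<close> conditions are measurable.\<close>

lemma (in sigma_finite_measure) pred_AE [measurable (raw)]:
  assumes [measurable]: "Measurable.pred (N \<Otimes>\<^sub>M M) (case_prod P)"
  shows "Measurable.pred N (\<lambda>y. AE s in M. P y s)"
proof -
  have "{z \<in> space (N \<Otimes>\<^sub>M M). \<not> case_prod P z} \<in> sets (N \<Otimes>\<^sub>M M)"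
    by measurable
  also have "{z \<in> space (N \<Otimes>\<^sub>M M). \<not> case_prod P z} =
      {z \<in> space (N \<Otimes>\<^sub>M M). snd z \<in> {s \<in> space M. \<not> P (fst z) s}}"
    by (auto simp: space_pair_measure)
  finally have [measurable]: "(\<lambda>y. emeasure M {s \<in> space M. \<not> P y s}) \<in> borel_measurable N"
    by (intro measurable_emeasure) auto
  have "(AE s in M. P y s) \<longleftrightarrow> emeasure M {s \<in> space M. \<not> P y s} = 0" if "y \<in> space N" for y
    using that by (intro AE_iff_measurable[OF _ refl]) measurable
  then show ?thesis
    by (subst measurable_cong) (assumption, measurable)
qed

text \<open>Fubini trades exceptional null sets that vary with \<open>x\<close> for one null set of
  \<open>y\<close>.\<close>

lemma (in pair_sigma_finite) AE_commuteI:
  assumes [measurable]: "Measurable.pred (M1 \<Otimes>\<^sub>M M2) (\<lambda>z. P (fst z) (snd z))"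
    and "\<And>x. x \<in> space M1 \<Longrightarrow> AE y in M2. P x y"
  shows "AE y in M2. AE x in M1. P x y"
  using assms(2) by (subst AE_commute[symmetric]) auto

section \<open>The median over the unit interval\<close>

text \<open>The lower median for Lebesgue measure on \<open>{0..1}\<close>. Unlike a mean, it makes
  sense for every measurable \<open>g\<close>, integrable or not.\<close>

definition median :: "(real \<Rightarrow> real) \<Rightarrow> real" where
  "median g = Inf {c. 1/2 \<le> measure lborel {s \<in> {0..1}. g s \<le> c}}"

lemma emeasure_sublevel_finite: "emeasure lborel {s \<in> {0..1}. g s \<le> c} < \<infinity>" for g :: "real \<Rightarrow> real"
proof -
  have "emeasure lborel {s \<in> {0..1}. g s \<le> c} \<le> emeasure lborel {0..1::real}"
    by (intro emeasure_mono) auto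
  then show ?thesis by (simp add: le_less_trans)
qed

lemma fmeasurable_sublevel:
  fixes g :: "real \<Rightarrow> real"
  assumes [measurable]: "g \<in> borel_measurable lborel"
  shows "{s \<in> {0..1}. g s \<le> c} \<in> fmeasurable lborel"
  using emeasure_sublevel_finite[of g c] by (intro fmeasurableI) auto

lemma median_level_mono:
  fixes g :: "real \<Rightarrow> real"
  assumes "g \<in> borel_measurable lborel" "c \<le> d"
  shows "measure lborel {s \<in> {0..1}. g s \<le> c} \<le> measure lborel {s \<in> {0..1}. g s \<le> d}"
  using assms by (intro measure_mono_fmeasurable fmeasurable_sublevel fmeasurableD) auto

text \<open>The sublevel sets at \<open>n\<close> increase to \<open>{0..1}\<close>, which has
  measure 1. Together with the lower bound below, this makes the infimum in \<open>median\<close> a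
  genuine one.\<close>

lemma median_levels_nonempty:
  fixes g :: "real \<Rightarrow> real"
  assumes g[measurable]: "g \<in> borel_measurable lborel"
  shows "{c. 1/2 \<le> measure lborel {s \<in> {0..1}. g s \<le> c}} \<noteq> {}"
proof -
  have "(\<lambda>n. measure lborel {s \<in> {0..1}. g s \<le> real n})
      \<longlonglongrightarrow> measure lborel (\<Union>n. {s \<in> {0..1}. g s \<le> real n})"
  proof (rule Lim_measure_incseq)
    have "emeasure lborel (\<Union>n. {s \<in> {0..1}. g s \<le> real n}) \<le> emeasure lborel {0..1::real}"
      by (intro emeasure_mono) auto
    then show "emeasure lborel (\<Union>n. {s \<in> {0..1}. g s \<le> real n}) \<noteq> \<infinity>"
      by (auto simp: top_unique)
  qed (auto simp: incseq_def intro: fmeasurableD[OF fmeasurable_sublevel[OF g]])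
  also have "(\<Union>n. {s \<in> {0..1}. g s \<le> real n}) = {0..1}"
    using real_arch_simple by fastforce
  finally have "(\<lambda>n. measure lborel {s \<in> {0..1}. g s \<le> real n}) \<longlonglongrightarrow> 1"
    by simp
  then have "\<forall>\<^sub>F n in sequentially. 1/2 < measure lborel {s \<in> {0..1}. g s \<le> real n}"
    by (rule order_tendstoD) simp
  then obtain n where "1/2 < measure lborel {s \<in> {0..1}. g s \<le> real n}"
    using eventually_happens'[OF sequentially_bot] by blast
  then show ?thesis
    by (auto intro!: exI[of _ "real n"])
qed

text \<open>The sublevel sets at \<open>- n\<close> decrease to the empty set, so some level carries
  mass below 1/2.\<close>

lemma bdd_below_median_levels:
  fixes g :: "real \<Rightarrow> real"
  assumes g[measurable]: "g \<in> borel_measurable lborel"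
  shows "bdd_below {c. 1/2 \<le> measure lborel {s \<in> {0..1}. g s \<le> c}}"
proof -
  have "(\<lambda>n. measure lborel {s \<in> {0..1}. g s \<le> - real n})
      \<longlonglongrightarrow> measure lborel (\<Inter>n. {s \<in> {0..1}. g s \<le> - real n})"
    using emeasure_sublevel_finite[of g]
    by (intro Lim_measure_decseq)
      (auto simp: decseq_def less_top intro: fmeasurableD[OF fmeasurable_sublevel[OF g]])
  also have "(\<Inter>n. {s \<in> {0..1}. g s \<le> - real n}) = {}"
  proof -
    have "\<exists>n. \<not> g s \<le> - real n" for s
      using reals_Archimedean2[of "- g s"] by (auto simp: not_le) (metis minus_less_iff)
    then show ?thesis by auto
  qed
  finally have "(\<lambda>n. measure lborel {s \<in> {0..1}. g s \<le> - real n}) \<longlonglongrightarrow> 0"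
    by simp
  then have "\<forall>\<^sub>F n in sequentially. measure lborel {s \<in> {0..1}. g s \<le> - real n} < 1/2"
    by (rule order_tendstoD) simp
  then obtain n where n: "measure lborel {s \<in> {0..1}. g s \<le> - real n} < 1/2"
    using eventually_happens'[OF sequentially_bot] by blast
  show ?thesis
  proof (rule bdd_belowI)
    fix c assume "c \<in> {c. 1/2 \<le> measure lborel {s \<in> {0..1}. g s \<le> c}}"
    with n median_level_mono[OF g, of c "- real n"] show "- real n \<le> c"
      by (cases "c \<le> - real n") auto
  qed
qed

lemma median_add_const:
  fixes g h :: "real \<Rightarrow> real"
  assumes [measurable]: "g \<in> borel_measurable lborel" "h \<in> borel_measurable lborel"
    and ae: "AE s in lborel. g s = h s + c"
  shows "median g = median h + c"
proof -
  have "measure lborel {s \<in> {0..1}. g s \<le> c + a} = measure lborel {s \<in> {0..1}. h s \<le> a}" for a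
  proof (rule measure_eq_AE)
    from ae show "AE s in lborel. s \<in> {s \<in> {0..1}. g s \<le> c + a} \<longleftrightarrow> s \<in> {s \<in> {0..1}. h s \<le> a}"
      by eventually_elim simp
  qed (simp_all add: fmeasurableD fmeasurable_sublevel)
  from this[of "a - c" for a] have level: "measure lborel {s \<in> {0..1}. g s \<le> a}
      = measure lborel {s \<in> {0..1}. h s \<le> a - c}" for a
    by simp
  have shift: "(+) c ` S = {a. a - c \<in> S}" for S
    by (auto simp: image_iff) (metis add.commute diff_add_cancel)
  have "{a. 1/2 \<le> measure lborel {s \<in> {0..1}. g s \<le> a}} =
      (+) c ` {a. 1/2 \<le> measure lborel {s \<in> {0..1}. h s \<le> a}}"
    by (simp only: shift level mem_Collect_eq)
  then have "median g = (INF a\<in>{a. 1/2 \<le> measure lborel {s \<in> {0..1}. h s \<le> a}}. c + a)"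
    by (simp add: median_def)
  also have "\<dots> = c + median h"
    using median_levels_nonempty[of h] bdd_below_median_levels[of h]
    by (subst Inf_add_eq) (auto simp: median_def)
  finally show ?thesis by simp
qed

text \<open>Sublevel mass is monotone in the level, so whether the median lies below
  \<open>a\<close> can be tested on the countably many rational levels below
  \<open>a\<close>.\<close>

lemma borel_measurable_median [measurable (raw)]:
  fixes g :: "'b \<Rightarrow> real \<Rightarrow> real"
  assumes g[measurable]: "case_prod g \<in> borel_measurable (N \<Otimes>\<^sub>M lborel)"
  shows "(\<lambda>y. median (g y)) \<in> borel_measurable N"
proof (subst borel_measurable_iff_less, rule allI)
  fix a :: real
  have [measurable]: "(\<lambda>y. measure lborel {s \<in> {0..1}. g y s \<le> q}) \<in> borel_measurable N" for q
  proof (rule lborel.measurable_measure)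
    have "{z \<in> space (N \<Otimes>\<^sub>M lborel). snd z \<in> {0..1} \<and> case_prod g z \<le> q} \<in> sets (N \<Otimes>\<^sub>M lborel)"
      by measurable
    then show "{z \<in> space (N \<Otimes>\<^sub>M lborel). snd z \<in> {s \<in> {0..1}. g (fst z) s \<le> q}} \<in> sets (N \<Otimes>\<^sub>M lborel)"
      by (simp add: case_prod_beta)
  qed auto
  have *: "median (g y) < a \<longleftrightarrow>
      (\<exists>q\<in>\<rat>. q < a \<and> 1/2 \<le> measure lborel {s \<in> {0..1}. g y s \<le> q})" if "y \<in> space N" for y
  proof -
    have [measurable]: "g y \<in> borel_measurable lborel"
      using measurable_Pair2[OF g that] by simp
    have "median (g y) < a \<longleftrightarrow> (\<exists>c<a. 1/2 \<le> measure lborel {s \<in> {0..1}. g y s \<le> c})"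
      unfolding median_def
      using median_levels_nonempty[of "g y"] bdd_below_median_levels[of "g y"]
      by (subst cInf_less_iff) auto
    also have "\<dots> \<longleftrightarrow> (\<exists>q\<in>\<rat>. q < a \<and> 1/2 \<le> measure lborel {s \<in> {0..1}. g y s \<le> q})"
    proof safe
      fix c assume "c < a" and c: "1/2 \<le> measure lborel {s \<in> {0..1}. g y s \<le> c}"
      from Rats_dense_in_real[OF \<open>c < a\<close>] obtain q where "q \<in> \<rat>" "c < q" "q < a"
        by auto
      with c median_level_mono[of "g y" c q]
      show "\<exists>q\<in>\<rat>. q < a \<and> 1/2 \<le> measure lborel {s \<in> {0..1}. g y s \<le> q}"
        by (intro bexI[of _ q]) auto
    qed auto
    finally show ?thesis .
  qed
  have "{y \<in> space N. \<exists>q\<in>\<rat>. q < a \<and> 1/2 \<le> measure lborel {s \<in> {0..1}. g y s \<le> q}} \<in> sets N"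
    by (intro sets.sets_Collect_countable_Ex' countable_rat) measurable
  then show "{y \<in> space N. median (g y) < a} \<in> sets N"
    using * by (simp cong: conj_cong)
qed

section \<open>Equality up to an additive constant\<close>

definition diff_const :: "(real \<Rightarrow> real) \<Rightarrow> (real \<Rightarrow> real) \<Rightarrow> bool" where
  "diff_const g h \<longleftrightarrow> (\<exists>c. AE s in lborel. g s = h s + c)"

text \<open>The only possible constant is the difference of the medians. Naming it removes the
  existential quantifier, which stands in the way of measurability.\<close>

lemma diff_const_iff_median:
  assumes [measurable]: "g \<in> borel_measurable lborel" "h \<in> borel_measurable lborel"
  shows "diff_const g h \<longleftrightarrow> (AE s in lborel. g s - median g = h s - median h)"
proof
  assume "diff_const g h"
  then obtain c where c: "AE s in lborel. g s = h s + c"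
    by (auto simp: diff_const_def)
  with median_add_const[of g h c] show "AE s in lborel. g s - median g = h s - median h"
    by auto
next
  assume "AE s in lborel. g s - median g = h s - median h"
  then have "AE s in lborel. g s = h s + (median g - median h)"
    by eventually_elim simp
  then show "diff_const g h" by (auto simp: diff_const_def)
qed

lemma diff_const_euclidean:
  assumes "diff_const f g" "diff_const f h"
  shows "diff_const g h"
proof -
  from assms obtain c d where "AE s in lborel. f s = g s + c" "AE s in lborel. f s = h s + d"
    by (auto simp: diff_const_def)
  then have "AE s in lborel. g s = h s + (d - c)"
    by eventually_elim simp
  then show ?thesis by (auto simp: diff_const_def)
qed

section \<open>The flow, the cocycle and the functional\<close>

locale almost_semi_additive = sigma_finite_measure M
  for M :: "'a measure" +
  fixes \<phi> :: "real \<Rightarrow> 'a \<Rightarrow> 'a" and A F :: "real \<Rightarrow> 'a \<Rightarrow> real"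
  assumes flow: "measurable_flow M \<phi>" "nonsingular_flow M \<phi>"
    and cocycle: "flow_cocycle M \<phi> A"
    and almost: "almost_semi_additive_functional M \<phi> A F"
begin

lemma flow_space [simp]: "x \<in> space M \<Longrightarrow> \<phi> t x \<in> space M"
  using flow by (auto simp: measurable_flow_def flow_on_def)

lemma flow_add: "x \<in> space M \<Longrightarrow> \<phi> s (\<phi> t x) = \<phi> (s + t) x"
  using flow by (auto simp: measurable_flow_def flow_on_def)

lemma flow_0 [simp]: "x \<in> space M \<Longrightarrow> \<phi> 0 x = x"
  using flow by (auto simp: measurable_flow_def flow_on_def)

lemma cocycle_nonzero [simp]: "x \<in> space M \<Longrightarrow> A t x \<noteq> 0"
  using cocycle measurable_space[of "\<lambda>(t, x). A t x" "borel \<Otimes>\<^sub>M M" "restrict_space borel (- {0})" "(t, x)"]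
  by (auto simp: flow_cocycle_def space_pair_measure space_restrict_space)

lemma cocycle_add: "x \<in> space M \<Longrightarrow> A (s + t) x = A s x * A t (\<phi> s x)"
  using cocycle by (auto simp: flow_cocycle_def)

lemma cocycle_0 [simp]: "x \<in> space M \<Longrightarrow> A 0 x = 1"
  using cocycle_add[of x 0 0] by simp

lemma measurable_flow_comp [measurable (raw)]:
  assumes [measurable]: "f \<in> borel_measurable N" "g \<in> N \<rightarrow>\<^sub>M M"
  shows "(\<lambda>y. \<phi> (f y) (g y)) \<in> N \<rightarrow>\<^sub>M M"
proof -
  have "(\<lambda>(t, x). \<phi> t x) \<in> borel \<Otimes>\<^sub>M M \<rightarrow>\<^sub>M M"
    using flow by (simp add: measurable_flow_def)
  from measurable_compose[OF _ this, of "\<lambda>y. (f y, g y)" N] show ?thesis by simp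
qed

lemma measurable_cocycle_comp [measurable (raw)]:
  assumes [measurable]: "f \<in> borel_measurable N" "g \<in> N \<rightarrow>\<^sub>M M"
  shows "(\<lambda>y. A (f y) (g y)) \<in> borel_measurable N"
proof -
  have "(\<lambda>(t, x). A t x) \<in> borel_measurable (borel \<Otimes>\<^sub>M M)"
    using cocycle by (simp add: flow_cocycle_def measurable_restrict_space2_iff)
  from measurable_compose[OF _ this, of "\<lambda>y. (f y, g y)" N] show ?thesis by simp
qed

lemma measurable_functional_comp [measurable (raw)]:
  assumes [measurable]: "f \<in> borel_measurable N" "g \<in> N \<rightarrow>\<^sub>M M"
  shows "(\<lambda>y. F (f y) (g y)) \<in> borel_measurable N"
proof -
  have "(\<lambda>(t, x). F t x) \<in> borel_measurable (borel \<Otimes>\<^sub>M M)"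
    using almost by (simp add: almost_semi_additive_functional_def)
  from measurable_compose[OF _ this, of "\<lambda>y. (f y, g y)" N] show ?thesis by simp
qed

lemma AE_flow:
  assumes "AE x in M. P x"
  shows "AE x in M. P (\<phi> t x)"
proof -
  from assms obtain N where N: "{x \<in> space M. \<not> P x} \<subseteq> N" "emeasure M N = 0" "N \<in> sets M"
    by (rule AE_E)
  have "emeasure M (\<phi> t -` N \<inter> space M) = 0"
    using flow(2) N by (auto simp: nonsingular_flow_def)
  moreover have "\<phi> t \<in> M \<rightarrow>\<^sub>M M"
    by measurable
  then have "\<phi> t -` N \<inter> space M \<in> sets M"
    using N(3) by (rule measurable_sets)
  moreover have "{x \<in> space M. \<not> P (\<phi> t x)} \<subseteq> \<phi> t -` N \<inter> space M"
    using N(1) flow_space by blast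
  ultimately show ?thesis
    by (intro AE_I)
qed

lemma AE_functional_add: "AE x in M. F (s + t) x = F s x + A s x * F t (\<phi> s x)"
  using almost by (simp add: almost_semi_additive_functional_def)

section \<open>Orbit profiles and their medians\<close>

text \<open>For an exactly semi-additive \<open>F\<close> this equals
  \<open>F s x - F r x\<close>.\<close>

definition orbit_profile :: "real \<Rightarrow> 'a \<Rightarrow> real \<Rightarrow> real" where
  "orbit_profile r x s = A r x * F (s - r) (\<phi> r x)"

lemma measurable_orbit_profile [measurable (raw)]:
  assumes [measurable]: "f \<in> borel_measurable N" "g \<in> N \<rightarrow>\<^sub>M M" "h \<in> borel_measurable N"
  shows "(\<lambda>y. orbit_profile (f y) (g y) (h y)) \<in> borel_measurable N"
  unfolding orbit_profile_def by measurable

lemma borel_measurable_orbit_profile [simp]: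
  assumes "x \<in> space M"
  shows "orbit_profile r x \<in> borel_measurable borel"
proof -
  have [measurable]: "(\<lambda>_. x) \<in> borel \<rightarrow>\<^sub>M M" using assms by simp
  have "(\<lambda>s. orbit_profile r x s) \<in> borel_measurable borel" by measurable
  then show ?thesis by simp
qed

lemma orbit_profile_0: "x \<in> space M \<Longrightarrow> orbit_profile 0 x s = F s x"
  by (simp add: orbit_profile_def)

text \<open>Both sides evaluate \<open>F\<close> at time \<open>s + t - r\<close> and point
  \<open>\<phi> r x\<close>; the factors agree because
  \<open>A t x * A (r - t) (\<phi> t x) = A r x\<close>.\<close>

lemma orbit_profile_flow:
  assumes "x \<in> space M"
  shows "A t x * orbit_profile (r - t) (\<phi> t x) s = orbit_profile r x (s + t)"
  using assms cocycle_add[of x t "r - t"]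
  by (simp add: orbit_profile_def flow_add algebra_simps)

definition profile_median :: "real \<Rightarrow> 'a \<Rightarrow> real" where
  "profile_median r x = median (orbit_profile r x)"

lemma measurable_profile_median [measurable (raw)]:
  assumes [measurable]: "f \<in> borel_measurable N" "g \<in> N \<rightarrow>\<^sub>M M"
  shows "(\<lambda>y. profile_median (f y) (g y)) \<in> borel_measurable N"
  unfolding profile_median_def by measurable

text \<open>For an exact \<open>F\<close>, with \<open>m x\<close> the median of
  \<open>s \<mapsto> F s x\<close>, this is \<open>F t x + A t x * m (\<phi> t x) - m x\<close>,
  whatever \<open>r\<close> is.\<close>

definition median_increment :: "real \<Rightarrow> real \<Rightarrow> 'a \<Rightarrow> real" where
  "median_increment t r x = A t x * profile_median (r - t) (\<phi> t x) - profile_median r x"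

lemma measurable_median_increment [measurable (raw)]:
  assumes [measurable]: "f \<in> borel_measurable N" "g \<in> borel_measurable N" "h \<in> N \<rightarrow>\<^sub>M M"
  shows "(\<lambda>y. median_increment (f y) (g y) (h y)) \<in> borel_measurable N"
  unfolding median_increment_def by measurable

lemma AE_orbit_profile_flow_eq:
  assumes x: "x \<in> space M"
    and ae: "AE s in lborel. orbit_profile r x s = orbit_profile r' x s + c"
  shows "AE s in lborel. orbit_profile (r - t) (\<phi> t x) s = orbit_profile (r' - t) (\<phi> t x) s + c / A t x"
  using AE_lborel_translate[OF ae, of t]
proof eventually_elim
  case (elim s)
  then have "A t x * orbit_profile (r - t) (\<phi> t x) s = A t x * orbit_profile (r' - t) (\<phi> t x) s + c"
    using x by (simp add: orbit_profile_flow)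
  then show ?case using x by (simp add: field_simps)
qed

text \<open>Replacing \<open>r'\<close> by \<open>r\<close> adds \<open>c\<close> to the median at
  \<open>x\<close> and \<open>c / A t x\<close> to the one at \<open>\<phi> t x\<close>; after
  multiplication by \<open>A t x\<close> the two changes cancel.\<close>

lemma median_increment_cong:
  assumes x: "x \<in> space M" and "diff_const (orbit_profile r x) (orbit_profile r' x)"
  shows "median_increment t r x = median_increment t r' x"
proof -
  from assms(2) obtain c where c: "AE s in lborel. orbit_profile r x s = orbit_profile r' x s + c"
    by (auto simp: diff_const_def)
  have "profile_median r x = profile_median r' x + c"
    unfolding profile_median_def using x c by (intro median_add_const) auto
  moreover have "profile_median (r - t) (\<phi> t x) = profile_median (r' - t) (\<phi> t x) + c / A t x"
    unfolding profile_median_def using x AE_orbit_profile_flow_eq[OF x c, of t]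
    by (intro median_add_const) auto
  ultimately show ?thesis
    using x by (simp add: median_increment_def algebra_simps)
qed

text \<open>The sum telescopes: the shifted index \<open>r - t\<close> makes the terms with
  \<open>profile_median (r - t) (\<phi> t x)\<close> cancel.\<close>

lemma median_increment_add:
  assumes "x \<in> space M"
  shows "median_increment (t + u) r x
    = median_increment t r x + A t x * median_increment u (r - t) (\<phi> t x)"
  using assms by (simp add: median_increment_def cocycle_add flow_add algebra_simps)

section \<open>The invariant set of consistent points\<close>

definition consistent :: "'a set" where
  "consistent = {x \<in> space M. AE r in lborel. AE r' in lborel.
     diff_const (orbit_profile r x) (orbit_profile r' x)}"

lemma consistent_space: "x \<in> consistent \<Longrightarrow> x \<in> space M"
  by (simp add: consistent_def)

lemma sets_consistent [measurable]: "consistent \<in> sets M"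
proof -
  \<comment> \<open>Normalising by medians leaves only \<open>AE\<close> quantifiers over a jointly
    measurable condition.\<close>
  have "consistent = {x \<in> space M. AE r in lborel. AE r' in lborel. AE s in lborel.
      orbit_profile r x s - profile_median r x = orbit_profile r' x s - profile_median r' x}"
    by (auto simp: consistent_def diff_const_iff_median profile_median_def)
  also have "\<dots> \<in> sets M" by measurable
  finally show ?thesis .
qed

lemma consistent_flow:
  assumes "x \<in> consistent"
  shows "\<phi> t x \<in> consistent"
proof -
  have x: "x \<in> space M" using assms by (rule consistent_space)
  have "AE r in lborel. AE r' in lborel. diff_const (orbit_profile (r + t) x) (orbit_profile r' x)"
    using assms by (intro AE_lborel_translate) (simp add: consistent_def)
  then have "AE r in lborel. AE r' in lborel. diff_const (orbit_profile r (\<phi> t x)) (orbit_profile r' (\<phi> t x))"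
  proof eventually_elim
    case (elim r)
    from AE_lborel_translate[OF this, of t] show ?case
    proof eventually_elim
      case (elim r')
      then obtain c where "AE s in lborel. orbit_profile (r + t) x s = orbit_profile (r' + t) x s + c"
        by (auto simp: diff_const_def)
      from AE_orbit_profile_flow_eq[OF x this, of t] show ?case
        by (auto simp: diff_const_def)
    qed
  qed
  with x show ?thesis by (simp add: consistent_def)
qed

lemma consistent_flow_iff:
  assumes "x \<in> space M"
  shows "\<phi> t x \<in> consistent \<longleftrightarrow> x \<in> consistent"
  using assms consistent_flow[of "\<phi> t x" "- t"] consistent_flow[of x t] by (auto simp: flow_add)

section \<open>The exact increment on consistent points\<close>

text \<open>Averaging over \<open>r\<close> is a measurable way to extract the almost everywhere constant value in \<open>r\<close>.\<close>

definition increment :: "real \<Rightarrow> 'a \<Rightarrow> real" where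
  "increment t x = (if x \<in> consistent
     then \<integral>r. indicator {0..1} r * median_increment t r x \<partial>lborel else 0)"

text \<open>For almost every fixed \<open>r\<close>, the integrand agrees almost everywhere on
  \<open>{0..1}\<close> with the constant \<open>median_increment t r x\<close>, and the interval
  has length 1.\<close>

lemma AE_increment_eq:
  assumes "x \<in> consistent"
  shows "AE r in lborel. increment t x = median_increment t r x"
proof -
  have x: "x \<in> space M" using assms by (rule consistent_space)
  have [measurable]: "(\<lambda>_. x) \<in> lborel \<rightarrow>\<^sub>M M" using x by simp
  have "AE r in lborel. AE r' in lborel. diff_const (orbit_profile r x) (orbit_profile r' x)"
    using assms by (simp add: consistent_def)
  then show ?thesis
  proof eventually_elim
    case (elim r)
    then have "AE r' in lborel. indicator {0..1} r' * median_increment t r' x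
        = indicator {0..1} r' * median_increment t r x"
      by eventually_elim (simp add: median_increment_cong[OF x, of r])
    then have "(\<integral>r'. indicator {0..1} r' * median_increment t r' x \<partial>lborel)
        = (\<integral>r'. indicator {0..1::real} r' * median_increment t r x \<partial>lborel)"
      by (intro integral_cong_AE) measurable
    also have "\<dots> = median_increment t r x" by simp
    finally show ?case using assms by (simp add: increment_def)
  qed
qed

lemma increment_add:
  assumes "x \<in> space M"
  shows "increment (t + u) x = increment t x + A t x * increment u (\<phi> t x)"
proof (cases "x \<in> consistent")
  case True
  \<comment> \<open>Shifting by \<open>- t\<close> produces the index \<open>r - t\<close> at
    \<open>\<phi> t x\<close> that the telescoping identity requires.\<close>
  have "AE r in lborel. increment u (\<phi> t x) = median_increment u (r + - t) (\<phi> t x)"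
    using True by (intro AE_lborel_translate AE_increment_eq consistent_flow)
  with AE_increment_eq[OF True, of "t + u"] AE_increment_eq[OF True, of t]
  have "AE r in (lborel :: real measure).
      increment (t + u) x = increment t x + A t x * increment u (\<phi> t x)"
    by eventually_elim (simp add: median_increment_add[OF assms])
  then show ?thesis by simp
next
  case False
  \<comment> \<open>The default value 0 is compatible with additivity because the complement of
    \<open>consistent\<close> is invariant too.\<close>
  then show ?thesis using assms by (simp add: increment_def consistent_flow_iff)
qed

section \<open>The semi-additive version\<close>

text \<open>On the space, \<open>profile_median 0 x\<close> is the median of
  \<open>s \<mapsto> F s x\<close>. The correction undoes the coboundary that
  \<open>median_increment\<close> carries for an exact \<open>F\<close>.\<close>

definition regularization :: "real \<Rightarrow> 'a \<Rightarrow> real" where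
  "regularization t x = increment t x + profile_median 0 x - A t x * profile_median 0 (\<phi> t x)"

lemma semi_additive_regularization: "semi_additive_functional M \<phi> A regularization"
proof -
  have "(\<lambda>(t, x). regularization t x) \<in> borel_measurable (borel \<Otimes>\<^sub>M M)"
    unfolding regularization_def increment_def by measurable
  moreover have "regularization (t + u) x = regularization t x + A t x * regularization u (\<phi> t x)"
    if "x \<in> space M" for t u x
    using that increment_add[OF that, of t u]
    by (simp add: regularization_def cocycle_add flow_add algebra_simps)
  ultimately show ?thesis by (simp add: semi_additive_functional_def)
qed

text \<open>For fixed \<open>r\<close> and \<open>s\<close>, almost semi-additivity at times
  \<open>r\<close> and \<open>s - r\<close> gives the constant \<open>F r x\<close>; two uses of
  Fubini bring \<open>x\<close> to the front.\<close>

lemma AE_profile_diff_const: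
  "AE x in M. AE r in lborel. diff_const (orbit_profile 0 x) (orbit_profile r x)"
proof -
  interpret pair_sigma_finite lborel M ..
  have "AE x in M. AE r in lborel. AE s in lborel. F s x = orbit_profile r x s + F r x"
  proof (rule AE_commuteI)
    fix r :: real
    show "AE x in M. AE s in lborel. F s x = orbit_profile r x s + F r x"
    proof (rule AE_commuteI)
      fix s :: real
      show "AE x in M. F s x = orbit_profile r x s + F r x"
        using AE_functional_add[of r "s - r"] by (auto simp: orbit_profile_def)
    qed measurable
  qed measurable
  then show ?thesis
    using AE_space
  proof eventually_elim
    case (elim x)
    from elim(1) show ?case
      by eventually_elim (use elim(2) in \<open>auto simp: diff_const_def orbit_profile_0\<close>)
  qed
qed

text \<open>Almost all profiles differ by a constant from the one at 0, hence from each
  other.\<close>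

lemma AE_consistent: "AE x in M. x \<in> consistent"
  using AE_profile_diff_const AE_space
proof eventually_elim
  case (elim x)
  from elim(1) have "AE r in lborel. AE r' in lborel. diff_const (orbit_profile r x) (orbit_profile r' x)"
  proof eventually_elim
    case (elim r)
    from \<open>AE r in lborel. diff_const (orbit_profile 0 x) (orbit_profile r x)\<close> show ?case
      by eventually_elim (rule diff_const_euclidean[OF elim])
  qed
  with elim(2) show ?case by (simp add: consistent_def)
qed

text \<open>Fix a generic \<open>r\<close>. Let \<open>c\<close> and \<open>d\<close> be the
  constants by which the profiles from 0 exceed those from \<open>r\<close> at \<open>x\<close> and
  from \<open>r - t\<close> at \<open>\<phi> t x\<close>. Both sides turn out to be
  \<open>c - A t x * d\<close>.\<close>

lemma version_regularization: "version_of M regularization F"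
  unfolding version_of_def
proof
  fix t
  interpret pair_sigma_finite lborel M ..
  have "AE x in M. AE s in lborel. F (t + s) x = F t x + A t x * F s (\<phi> t x)"
    by (rule AE_commuteI) (measurable, rule AE_functional_add)
  with AE_profile_diff_const AE_flow[OF AE_profile_diff_const, of t] AE_consistent AE_space
  show "AE x in M. regularization t x = F t x"
  proof eventually_elim
    case (elim x)
    then have x: "x \<in> space M" by simp
    have "AE r in lborel. diff_const (orbit_profile 0 (\<phi> t x)) (orbit_profile (r + - t) (\<phi> t x))"
      using elim by (intro AE_lborel_translate)
    with elim(1) AE_increment_eq[OF elim(3), of t]
    have "AE r in (lborel :: real measure). regularization t x = F t x"
    proof eventually_elim
      case r: (elim r)
      from r(1) obtain c where c: "AE s in lborel. orbit_profile 0 x s = orbit_profile r x s + c"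
        by (auto simp: diff_const_def)
      from r(3) obtain d where
        d: "AE s in lborel. orbit_profile 0 (\<phi> t x) s = orbit_profile (r - t) (\<phi> t x) s + d"
        by (auto simp: diff_const_def)
      have "profile_median 0 x = profile_median r x + c"
        unfolding profile_median_def using x c by (intro median_add_const) auto
      moreover have "profile_median 0 (\<phi> t x) = profile_median (r - t) (\<phi> t x) + d"
        unfolding profile_median_def using x d by (intro median_add_const) auto
      ultimately have "regularization t x = c - A t x * d"
        using r(2) by (simp add: regularization_def median_increment_def algebra_simps)
      \<comment> \<open>At a generic \<open>s\<close>, \<open>F (t + s) x\<close> is expanded once
        by almost semi-additivity and once through the profile from \<open>r\<close>; the common
        profile term cancels.\<close>
      moreover have "AE s in (lborel :: real measure). F t x = c - A t x * d"
        using elim(5) AE_lborel_translate[OF c, of t] d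
      proof eventually_elim
        case (elim s)
        then show ?case
          using orbit_profile_flow[OF x, of t r s] x
          by (simp add: orbit_profile_0 algebra_simps)
      qed
      ultimately show ?case by simp
    qed
    then show ?case by simp
  qed
qed

end

theorem theorem2p1:
  fixes M :: "'a measure"
    and \<phi> :: "real \<Rightarrow> 'a \<Rightarrow> 'a"
    and A F :: "real \<Rightarrow> 'a \<Rightarrow> real"
  assumes "standard_lebesgue_space M"
    and "measurable_flow M \<phi>"
    and "nonsingular_flow M \<phi>"
    and "flow_cocycle M \<phi> A"
    and "almost_semi_additive_functional M \<phi> A F"
  shows "\<exists>G. version_of M G F \<and> semi_additive_functional M \<phi> A G"
proof -
  interpret sigma_finite_measure M
    using assms(1) by (simp add: standard_lebesgue_space_def)
  interpret almost_semi_additive M \<phi> A F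
    by unfold_locales fact+
  show ?thesis
    using version_regularization semi_additive_regularization by blast
qed

end
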